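(* Let $A$ and $B$ be two elements of a unital associative algebra over $\mathbb{C}$ with unity $I$ satisfying $AB-BA=I$. Put $A_1=A$, let $A_2$ and $A_3$ be formal power series in $A$ and $B$ in $(B,A)$-normal form, $$A_2=\sum_{j,k=0}^{\infty}a_{jk}B^jA^k,\qquad A_3=\sum_{j,k=0}^{\infty}\tilde a_{jk}B^jA^k,$$ with $a_{jk},\tilde a_{jk}\in\mathbb{C}$, and let $$T(A,B)=\sum_{k=0}^{\infty}\frac{(-2)^k}{k!}B^kA^k.$$ If $A_1,A_2,A_3$ satisfy $$A_1A_2+A_2A_1=A_3,\qquad A_1A_3+A_3A_1=0,\qquad A_2A_3+A_3A_2=0,$$ then either (i) $A_3=0$ and $A_2=T(A,B)V(A)$ for some formal power series $V(A)$ in $A$ with complex coefficients; or (ii) there exist a non-zero constant $c\in\mathbb{C}$ and odd formal power series $\varphi(A)$ and $\psi(A)$ in $A$ with complex coefficients such that $$A_2=c\,T(A,B)\,E(\varphi(A))\Bigl[e^{\varphi(A)}\psi(A)-\tfrac12\varphi'(A)\Bigr]+c\,B\,T(A,B)\,e^{\varphi(A)},$$ $$A_3=c\,T(A,B)\,e^{\varphi(A)},$$ where $E(t)=\sum_{n=0}^{\infty}\frac{E_{2n}}{(2n)!}t^{2n}$ is the exponential generating function of the Euler numbers $E_k$.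
   Context: A formal power series in $A$ and $B$ in $(B,A)$-normal form is a formal expression $\sum_{j,k\ge 0}a_{jk}B^jA^k$ with $a_{jk}\in\mathbb{C}$ (in every monomial all $B$'s stand to the left of all $A$'s). Two such formal series are equal if and only if all their coefficients coincide. Products of formal series are computed by bilinear extension of the reordering rule that follows from $AB-BA=I$, $$(B^jA^k)(B^mA^n)=\sum_{\nu=0}^{\min(k,m)}\nu!\binom{k}{\nu}\binom{m}{\nu}B^{j+m-\nu}A^{k+n-\nu},$$ a product being defined when each coefficient of the result is a sum with only finitely many non-zero terms. A series in $A$ alone is a special case. A formal power series in $A$ is odd if only odd powers of $A$ occur; $\varphi'$ denotes the formal (term-wise) derivative; $e^{\varphi(A)}$ and $E(\varphi(A))$ are formal compositions (well defined since $\varphi$ has zero constant term). The Euler numbers $E_k$ are defined by $\frac{2e^t}{e^{2t}+1}=\sum_{k=0}^{\infty}E_k\frac{t^k}{k!}$; $E_k=0$ for odd $k$, so $E(t)=1/\cosh t$ as a formal power series. *)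

theory Defs
  imports Complex_Main "HOL-Computational_Algebra.Formal_Power_Series"
begin

text \<open>
  Formal power series in \<open>A\<close> and \<open>B\<close> in \<open>(B,A)\<close>-normal form are identified with their
  coefficient families: \<open>ns_coeff X j k\<close> is the coefficient of \<open>B\<^sup>j A\<^sup>k\<close> in \<open>X\<close>.
\<close>

typedef normal_series = "UNIV :: (nat \<Rightarrow> nat \<Rightarrow> complex) set"
  morphisms ns_coeff Normal_Series ..

lemma ns_coeff_Normal_Series [simp]: "ns_coeff (Normal_Series a) = a"
  by (simp add: Normal_Series_inverse)

lemma normal_series_eqI: "(\<And>j k. ns_coeff X j k = ns_coeff Y j k) \<Longrightarrow> X = Y"
  by (metis ext ns_coeff_inject)

definition ns_monom :: "nat \<Rightarrow> nat \<Rightarrow> normal_series" where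
  "ns_monom m n = Normal_Series (\<lambda>j k. if j = m \<and> k = n then 1 else 0)"

text \<open>
  \<open>monom_prod_coeff j k m n p q\<close> is the coefficient of \<open>B\<^sup>p A\<^sup>q\<close> in
  \<open>(B\<^sup>j A\<^sup>k)(B\<^sup>m A\<^sup>n) = (\<Sum>\<nu>\<le>min k m. \<nu>! (k choose \<nu>) (m choose \<nu>) B\<^bsup>j+m-\<nu>\<^esup> A\<^bsup>k+n-\<nu>\<^esup>)\<close>.
\<close>

definition monom_prod_coeff :: "nat \<Rightarrow> nat \<Rightarrow> nat \<Rightarrow> nat \<Rightarrow> nat \<Rightarrow> nat \<Rightarrow> complex" where
  "monom_prod_coeff j k m n p q =
     (\<Sum>\<nu>\<le>min k m. if j + m - \<nu> = p \<and> k + n - \<nu> = q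
        then fact \<nu> * of_nat (k choose \<nu>) * of_nat (m choose \<nu>) else 0)"

definition prod_term ::
    "normal_series \<Rightarrow> normal_series \<Rightarrow> nat \<Rightarrow> nat \<Rightarrow> nat \<times> nat \<times> nat \<times> nat \<Rightarrow> complex" where
  "prod_term X Y p q = (\<lambda>(j, k, m, n).
     ns_coeff X j k * ns_coeff Y m n * monom_prod_coeff j k m n p q)"

definition prod_defined :: "normal_series \<Rightarrow> normal_series \<Rightarrow> bool" where
  "prod_defined X Y \<longleftrightarrow> (\<forall>p q. finite {i. prod_term X Y p q i \<noteq> 0})"

text \<open>
  The product below is a total function, but it has its intended meaning only if
  \<^const>\<open>prod_defined\<close> holds; otherwise the coefficients with infinitely many non-zero terms
  are set to \<open>0\<close>.
\<close>

instantiation normal_series :: "{one, times, ab_group_add}"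
begin

definition "0 = Normal_Series (\<lambda>j k. 0)"
definition "1 = ns_monom 0 0"
definition "X + Y = Normal_Series (\<lambda>j k. ns_coeff X j k + ns_coeff Y j k)"
definition "X - Y = Normal_Series (\<lambda>j k. ns_coeff X j k - ns_coeff Y j k)"
definition "- X = Normal_Series (\<lambda>j k. - ns_coeff X j k)"
definition "X * Y = Normal_Series (\<lambda>p q. \<Sum>i | prod_term X Y p q i \<noteq> 0. prod_term X Y p q i)"

instance
  by standard (auto intro!: normal_series_eqI simp: zero_normal_series_def
      plus_normal_series_def minus_normal_series_def uminus_normal_series_def)

end

definition ns_scale :: "complex \<Rightarrow> normal_series \<Rightarrow> normal_series"  (infixr "*\<^sub>N" 75) where
  "c *\<^sub>N X = Normal_Series (\<lambda>j k. c * ns_coeff X j k)"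

abbreviation opA :: normal_series where "opA \<equiv> ns_monom 0 1"
abbreviation opB :: normal_series where "opB \<equiv> ns_monom 1 0"

text \<open>\<open>of_A V\<close> is the series \<open>V(A)\<close> in \<open>A\<close> alone.\<close>

definition of_A :: "complex fps \<Rightarrow> normal_series" where
  "of_A V = Normal_Series (\<lambda>j k. if j = 0 then fps_nth V k else 0)"

definition opT :: normal_series where
  "opT = Normal_Series (\<lambda>j k. if j = k then (-2) ^ k / fact k else 0)"

text \<open>\<open>XY + YX = Z\<close>, including that both products are defined.\<close>

definition anticommutator_eq :: "normal_series \<Rightarrow> normal_series \<Rightarrow> normal_series \<Rightarrow> bool" where
  "anticommutator_eq X Y Z \<longleftrightarrow> prod_defined X Y \<and> prod_defined Y X \<and> X * Y + Y * X = Z"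

definition odd_fps :: "complex fps \<Rightarrow> bool" where
  "odd_fps f \<longleftrightarrow> (\<forall>n. even n \<longrightarrow> fps_nth f n = 0)"

definition euler_number :: "nat \<Rightarrow> complex" where
  "euler_number k = fact k * fps_nth (2 * fps_exp 1 / (fps_exp 2 + 1)) k"

definition euler_egf :: "complex fps" where
  "euler_egf = Abs_fps (\<lambda>k. if even k then euler_number k / fact k else 0)"

text \<open>
  The following facts check the encoding. In particular, left and right multiplication by \<open>A\<close>,
  left multiplication by \<open>B\<close> and right multiplication by a series in \<open>A\<close> are always defined.
\<close>

lemma ns_coeff_simps [simp]:
  "ns_coeff 0 j k = 0"
  "ns_coeff (ns_monom m n) j k = (if j = m \<and> k = n then 1 else 0)"
  "ns_coeff (X + Y) j k = ns_coeff X j k + ns_coeff Y j k"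
  "ns_coeff (X - Y) j k = ns_coeff X j k - ns_coeff Y j k"
  "ns_coeff (- X) j k = - ns_coeff X j k"
  "ns_coeff (c *\<^sub>N X) j k = c * ns_coeff X j k"
  "ns_coeff (of_A V) j k = (if j = 0 then fps_nth V k else 0)"
  by (simp_all add: zero_normal_series_def ns_monom_def plus_normal_series_def
      minus_normal_series_def uminus_normal_series_def ns_scale_def of_A_def)

lemma monom_prod_coeff_nonzero:
  assumes "monom_prod_coeff j k m n p q \<noteq> 0"
  obtains v where "v \<le> k" "v \<le> m" "j + m - v = p" "k + n - v = q"
proof -
  have "\<exists>v\<in>{..min k m}. (if j + m - v = p \<and> k + n - v = q
        then fact v * of_nat (k choose v) * of_nat (m choose v) else 0 :: complex) \<noteq> 0"
    using assms unfolding monom_prod_coeff_def by (rule sum.not_neutral_contains_not_neutral) blast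
  then show thesis using that by (auto split: if_splits)
qed

lemma prod_definedI:
  assumes "\<And>p q. \<exists>N. \<forall>j k m n. ns_coeff X j k \<noteq> 0 \<longrightarrow> ns_coeff Y m n \<noteq> 0 \<longrightarrow>
      monom_prod_coeff j k m n p q \<noteq> 0 \<longrightarrow> j \<le> N \<and> k \<le> N \<and> m \<le> N \<and> n \<le> N"
  shows "prod_defined X Y"
  unfolding prod_defined_def
proof (intro allI)
  fix p q
  obtain N where N: "\<forall>j k m n. ns_coeff X j k \<noteq> 0 \<longrightarrow> ns_coeff Y m n \<noteq> 0 \<longrightarrow>
      monom_prod_coeff j k m n p q \<noteq> 0 \<longrightarrow> j \<le> N \<and> k \<le> N \<and> m \<le> N \<and> n \<le> N"
    using assms by blast
  have "{i. prod_term X Y p q i \<noteq> 0} \<subseteq> {..N} \<times> {..N} \<times> {..N} \<times> {..N}"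
    using N by (auto simp: prod_term_def)
  then show "finite {i. prod_term X Y p q i \<noteq> 0}"
    by (rule finite_subset) simp
qed

lemma prod_defined_right_of_A: "prod_defined X (of_A V)"
proof (rule prod_definedI)
  fix p q
  show "\<exists>N. \<forall>j k m n. ns_coeff X j k \<noteq> 0 \<longrightarrow> ns_coeff (of_A V) m n \<noteq> 0 \<longrightarrow>
      monom_prod_coeff j k m n p q \<noteq> 0 \<longrightarrow> j \<le> N \<and> k \<le> N \<and> m \<le> N \<and> n \<le> N"
    by (rule exI[of _ "p + q"])
      (auto elim!: monom_prod_coeff_nonzero split: if_splits)
qed

lemma prod_defined_left_opA: "prod_defined opA X"
proof (rule prod_definedI)
  fix p q
  show "\<exists>N. \<forall>j k m n. ns_coeff opA j k \<noteq> 0 \<longrightarrow> ns_coeff X m n \<noteq> 0 \<longrightarrow>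
      monom_prod_coeff j k m n p q \<noteq> 0 \<longrightarrow> j \<le> N \<and> k \<le> N \<and> m \<le> N \<and> n \<le> N"
    by (rule exI[of _ "p + q + 1"])
      (auto elim!: monom_prod_coeff_nonzero split: if_splits)
qed

lemma prod_defined_left_opB: "prod_defined opB X"
proof (rule prod_definedI)
  fix p q
  show "\<exists>N. \<forall>j k m n. ns_coeff opB j k \<noteq> 0 \<longrightarrow> ns_coeff X m n \<noteq> 0 \<longrightarrow>
      monom_prod_coeff j k m n p q \<noteq> 0 \<longrightarrow> j \<le> N \<and> k \<le> N \<and> m \<le> N \<and> n \<le> N"
    by (rule exI[of _ "p + q + 1"])
      (auto elim!: monom_prod_coeff_nonzero split: if_splits)
qed

lemma of_A_X: "of_A fps_X = opA"
  by (rule normal_series_eqI) (auto simp: fps_X_def)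

lemma prod_defined_right_opA: "prod_defined X opA"
  using prod_defined_right_of_A[of X fps_X] by (simp add: of_A_X)

lemma ns_coeff_mult:
  assumes "finite S" "{i. prod_term X Y p q i \<noteq> 0} \<subseteq> S"
  shows "ns_coeff (X * Y) p q = (\<Sum>i\<in>S. prod_term X Y p q i)"
  unfolding times_normal_series_def ns_coeff_Normal_Series
  using assms by (intro sum.mono_neutral_left) auto

lemma ns_coeff_monom_mult:
  "ns_coeff (ns_monom j k * ns_monom m n) p q = monom_prod_coeff j k m n p q"
  by (subst ns_coeff_mult[of "{(j, k, m, n)}"]) (auto simp: prod_term_def split: if_splits)

lemma opA_opB_commutator: "opA * opB - opB * opA = 1"
proof (rule normal_series_eqI)
  fix p q
  have 1: "monom_prod_coeff 0 1 1 0 p q =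
      (if p = 1 \<and> q = 1 then 1 else 0) + (if p = 0 \<and> q = 0 then 1 else 0)"
    by (auto simp: monom_prod_coeff_def atMost_Suc)
  have 2: "monom_prod_coeff 1 0 0 1 p q = (if p = 1 \<and> q = 1 then 1 else 0)"
    by (auto simp: monom_prod_coeff_def)
  show "ns_coeff (opA * opB - opB * opA) p q = ns_coeff 1 p q"
    by (simp only: ns_coeff_simps ns_coeff_monom_mult one_normal_series_def 1 2) simp
qed

lemma of_A_mult: "of_A (V * W) = of_A V * of_A W"
proof (rule normal_series_eqI)
  fix p q
  let ?h = "\<lambda>i. (0, i, 0, q - i) :: nat \<times> nat \<times> nat \<times> nat"
  have inj: "inj_on ?h {0..q}" by (auto simp: inj_on_def)
  have sub: "{i. prod_term (of_A V) (of_A W) p q i \<noteq> 0} \<subseteq> ?h ` {0..q}"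
    by (auto simp: prod_term_def image_iff elim!: monom_prod_coeff_nonzero split: if_splits)
  have "ns_coeff (of_A V * of_A W) p q =
      (\<Sum>i=0..q. prod_term (of_A V) (of_A W) p q (?h i))"
    by (subst ns_coeff_mult[OF _ sub]) (simp_all add: sum.reindex[OF inj])
  also have "\<dots> = ns_coeff (of_A (V * W)) p q"
    by (auto simp: prod_term_def monom_prod_coeff_def fps_mult_nth)
  finally show "ns_coeff (of_A (V * W)) p q = ns_coeff (of_A V * of_A W) p q" ..
qed

end

theory Submission
  imports Defs
begin

text \<open>
  In the representation where \<open>B\<close> multiplies by \<open>x\<close> and \<open>A\<close> differentiates,
  \<open>T = \<Sum>\<^sub>k (-2)\<^sup>k/k! B\<^sup>k A\<^sup>k\<close> is by Taylor's formula the parity operator \<open>f(x) \<mapsto> f(-x)\<close>. It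
  therefore anticommutes with \<open>A\<close> and \<open>B\<close> and satisfies \<open>T\<^sup>2 = I\<close> and \<open>T V(A) T = V(-A)\<close>.

  Write a normal series as \<open>\<Sum>\<^sub>j B\<^sup>j f\<^sub>j(A)\<close>. The operation \<open>X \<mapsto> AX + XA\<close> replaces the row \<open>f\<^sub>j\<close>
  by \<open>2A f\<^sub>j + (j+1) f\<^bsub>j+1\<^esub>\<close>, so a series is determined by its image under this operation
  together with its constant row \<open>f\<^sub>0\<close> (\<open>opA_anticommutator_inject\<close>). Since \<open>T W(A)\<close> has image
  \<open>0\<close> and \<open>B T W(A)\<close> has image \<open>T W(A)\<close>, the first two relations say exactly that
  \<open>A\<^sub>3 = T W(A)\<close> and \<open>A\<^sub>2 = T V(A) + B T W(A)\<close>, where \<open>V\<close> and \<open>W\<close> are the constant rows of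
  \<open>A\<^sub>2\<close> and \<open>A\<^sub>3\<close>.

  Moving both factors \<open>T\<close> together, \<open>A\<^sub>2 A\<^sub>3 + A\<^sub>3 A\<^sub>2\<close> is a series in \<open>A\<close> alone, and its vanishing
  amounts to
  \<open>V(-t) W(t) + W(-t) V(t) + W'(-t) W(t) = 0\<close>.
  So the relation can be read off from the constant row of the product. The coefficients of that row
  are finite sums that can be evaluated directly (\<open>row_0_mult_opT_of_A\<close>,
  \<open>row_0_mult_opB_opT_of_A\<close>), which avoids the question of associativity for partially defined
  products.

  If \<open>W = 0\<close>, this is case (i). Otherwise, the first two summands together are invariant under
  \<open>t \<mapsto> -t\<close>, hence so is \<open>W'(-t) W(t)\<close>. This means that \<open>W(t) W(-t)\<close> has derivative zero, so it
  is a constant, which is non-zero because formal power series form a domain. Consequently \<open>W\<close> is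
  invertible and \<open>W'/W\<close> is even, so that \<open>W = c e\<^sup>\<phi>\<close> with \<open>\<phi>\<close> odd (\<open>odd_logarithm_exists\<close>). With
  \<open>V = c v\<close> the equation becomes
  \<open>e\<^sup>\<phi> v(-t) + e\<^bsup>-\<phi>\<^esup> v + \<phi>' = 0\<close>, and multiplying it by \<open>cosh \<phi>\<close> shows that
  \<open>\<psi> = e\<^bsup>-\<phi>\<^esup> (v cosh \<phi> + \<phi>'/2)\<close> is odd. Solving for \<open>v\<close> gives
  \<open>v = (e\<^sup>\<phi> \<psi> - \<phi>'/2) / cosh \<phi>\<close>, which is case (ii).
\<close>

section \<open>Reflection of formal power series\<close>

definition fps_reflect :: "'a::comm_ring_1 fps \<Rightarrow> 'a fps" where
  "fps_reflect f = f oo - fps_X"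

lemma fps_reflect_nth [simp]: "fps_nth (fps_reflect f) n = (-1) ^ n * fps_nth f n"
  by (simp add: fps_reflect_def fps_compose_uminus')

lemma fps_reflect_reflect [simp]: "fps_reflect (fps_reflect f) = f"
  by (rule fps_ext) (simp flip: mult.assoc power_mult_distrib)

lemma fps_reflect_add [simp]: "fps_reflect (f + g) = fps_reflect f + fps_reflect g"
  by (simp add: fps_reflect_def fps_compose_add_distrib)

lemma fps_reflect_uminus [simp]: "fps_reflect (- f) = - fps_reflect f"
  by (simp add: fps_reflect_def fps_compose_uminus)

lemma fps_reflect_mult [simp]:
  fixes f g :: "'a::idom fps"
  shows "fps_reflect (f * g) = fps_reflect f * fps_reflect g"
  by (simp add: fps_reflect_def fps_compose_mult_distrib)

lemma fps_reflect_const [simp]: "fps_reflect (fps_const c) = fps_const c"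
  by (simp add: fps_reflect_def)

lemma fps_reflect_zero [simp]: "fps_reflect 0 = 0"
  by (simp add: fps_reflect_def)

lemma fps_reflect_exp: "fps_reflect (fps_exp (a :: 'a::field_char_0)) = fps_exp (- a)"
  by (simp add: fps_reflect_def)

lemma fps_deriv_reflect: "fps_deriv (fps_reflect f) = - fps_reflect (fps_deriv f)"
  by (rule fps_ext) simp

lemma fps_reflect_compose:
  fixes f g :: "'a::idom fps"
  assumes "fps_nth g 0 = 0"
  shows "fps_reflect (f oo g) = f oo fps_reflect g"
  using assms by (simp add: fps_reflect_def fps_compose_assoc)

lemma odd_fps_iff_reflect: "odd_fps f \<longleftrightarrow> fps_reflect f = - f"
proof
  assume "odd_fps f"
  then show "fps_reflect f = - f"
    by (intro fps_ext) (auto simp: odd_fps_def minus_one_power_iff)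
next
  assume eq: "fps_reflect f = - f"
  have "fps_nth f n = 0" if "even n" for n
    using arg_cong[OF eq, of "\<lambda>g. fps_nth g n"] that by simp
  then show "odd_fps f"
    by (simp add: odd_fps_def)
qed

section \<open>Rows of a normal series\<close>

text \<open>
  The power series \<open>f\<^sub>j\<close> in \<open>\<Sum>\<^sub>j B\<^sup>j f\<^sub>j(A)\<close>. Since all series in \<open>A\<close> commute, the rows can be handled
  with ordinary power series arithmetic: right multiplication by \<open>V(A)\<close> multiplies each row by \<open>V\<close>.
\<close>

definition row :: "normal_series \<Rightarrow> nat \<Rightarrow> complex fps" where
  "row X j = Abs_fps (ns_coeff X j)"

lemma row_nth [simp]: "fps_nth (row X j) k = ns_coeff X j k"
  by (simp add: row_def)

lemma normal_series_eq_rowI: "(\<And>j. row X j = row Y j) \<Longrightarrow> X = Y"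
  by (metis normal_series_eqI row_nth)

lemma row_zero [simp]: "row 0 j = 0"
  by (rule fps_ext) simp

lemma row_add [simp]: "row (X + Y) j = row X j + row Y j"
  by (rule fps_ext) simp

lemma row_scale [simp]: "row (c *\<^sub>N X) j = fps_const c * row X j"
  by (rule fps_ext) simp

lemma row_opT: "row opT j = fps_const ((-2) ^ j / fact j) * fps_X ^ j"
  by (rule fps_ext) (auto simp: opT_def fps_X_power_iff)

lemma row_mult_of_A [simp]: "row (X * of_A V) p = row X p * V"
proof (rule fps_ext)
  fix q
  have coeff: "monom_prod_coeff j k 0 n p q = (if j = p \<and> k + n = q then 1 else 0)" for j k n
    by (auto simp: monom_prod_coeff_def)
  let ?h = "\<lambda>i. (p, i, 0, q - i) :: nat \<times> nat \<times> nat \<times> nat"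
  have inj: "inj_on ?h {0..q}" by (auto simp: inj_on_def)
  have sub: "{i. prod_term X (of_A V) p q i \<noteq> 0} \<subseteq> ?h ` {0..q}"
    by (auto simp: prod_term_def coeff image_iff split: if_splits)
  have "ns_coeff (X * of_A V) p q = (\<Sum>i=0..q. prod_term X (of_A V) p q (?h i))"
    by (subst ns_coeff_mult[OF _ sub]) (simp_all add: sum.reindex[OF inj])
  then show "fps_nth (row (X * of_A V) p) q = fps_nth (row X p * V) q"
    by (simp add: prod_term_def coeff fps_mult_nth)
qed

text \<open>
  This is \<open>A B\<^sup>j = B\<^sup>j A + j B\<^bsup>j-1\<^esup>\<close> read off row by row.
\<close>

lemma row_opA_mult:
  "row (opA * X) p = fps_X * row X p + of_nat (Suc p) * row X (Suc p)"
proof (rule fps_ext)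
  fix q
  have coeff: "monom_prod_coeff 0 1 m n p q =
      (if m = p \<and> Suc n = q then 1 else 0) + (if m = Suc p \<and> n = q then of_nat m else 0)" for m n
    by (cases m) (auto simp: monom_prod_coeff_def atMost_Suc)
  let ?S = "{(0, 1, p, q - 1), (0, 1, Suc p, q)} :: (nat \<times> nat \<times> nat \<times> nat) set"
  have "{i. prod_term opA X p q i \<noteq> 0} \<subseteq> ?S"
    by (auto simp: prod_term_def coeff[simplified] split: if_splits)
  then have "ns_coeff (opA * X) p q = (\<Sum>i\<in>?S. prod_term opA X p q i)"
    by (intro ns_coeff_mult) auto
  then show "fps_nth (row (opA * X) p) q =
      fps_nth (fps_X * row X p + of_nat (Suc p) * row X (Suc p)) q"
    by (simp add: prod_term_def coeff[simplified] fps_of_nat[symmetric]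
        del: of_nat_Suc fps_const_add)
qed

lemma row_opB_mult: "row (opB * X) p = (if p = 0 then 0 else row X (p - 1))"
proof (rule fps_ext)
  fix q
  have coeff: "monom_prod_coeff 1 0 m n p q = (if Suc m = p \<and> n = q then 1 else 0)" for m n
    by (auto simp: monom_prod_coeff_def)
  have "{i. prod_term opB X p q i \<noteq> 0} \<subseteq> {(1, 0, p - 1, q)}"
    by (auto simp: prod_term_def coeff[simplified] split: if_splits)
  then have "ns_coeff (opB * X) p q = (\<Sum>i\<in>{(1, 0, p - 1, q)}. prod_term opB X p q i)"
    by (intro ns_coeff_mult) auto
  then show "fps_nth (row (opB * X) p) q = fps_nth (if p = 0 then 0 else row X (p - 1)) q"
    by (simp add: prod_term_def coeff[simplified])
qed

lemma row_opA_anticommutator: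
  "row (opA * X + X * opA) p = 2 * fps_X * row X p + of_nat (Suc p) * row X (Suc p)"
  using row_mult_of_A[of X fps_X]
  by (simp add: row_opA_mult of_A_X algebra_simps del: One_nat_def)

lemma opA_anticommutator_add:
  "opA * (X + Y) + (X + Y) * opA = (opA * X + X * opA) + (opA * Y + Y * opA)"
proof (rule normal_series_eq_rowI)
  fix p
  have "row (opA * (X + Y) + (X + Y) * opA) p = row (opA * X + X * opA) p + row (opA * Y + Y * opA) p"
    unfolding row_opA_anticommutator by (simp add: algebra_simps)
  then show "row (opA * (X + Y) + (X + Y) * opA) p = row ((opA * X + X * opA) + (opA * Y + Y * opA)) p"
    by (simp only: row_add)
qed

text \<open>
  The row formula for \<open>AX + XA\<close> can be solved for the row \<open>p + 1\<close> because its factor \<open>p + 1\<close> is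
  invertible, so the constant row starts a recursion for all others.
\<close>

lemma opA_anticommutator_inject:
  assumes "opA * X + X * opA = opA * Y + Y * opA" and "row X 0 = row Y 0"
  shows "X = Y"
proof (rule normal_series_eq_rowI)
  fix p
  show "row X p = row Y p"
  proof (induction p)
    case (Suc p)
    have "of_nat (Suc p) * row X (Suc p) = of_nat (Suc p) * row Y (Suc p)"
      using row_opA_anticommutator[of X p] row_opA_anticommutator[of Y p]
      unfolding assms(1) Suc by (metis add_left_cancel)
    then show ?case
      by (simp del: of_nat_Suc)
  qed (fact assms(2))
qed

lemma row_opT_of_A: "row (opT * of_A G) j = fps_const ((-2) ^ j / fact j) * (fps_X ^ j * G)"
  by (simp add: row_opT mult.assoc)

text \<open>
  The coefficients \<open>(-2)\<^sup>k/k!\<close> of \<open>T\<close> are those for which \<open>2A f\<^sub>p\<close> and \<open>(p+1) f\<^bsub>p+1\<^esub>\<close> cancel.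
\<close>

lemma opA_anticommutes_opT_of_A:
  "opA * (opT * of_A G) + (opT * of_A G) * opA = 0"
proof (rule normal_series_eq_rowI)
  fix p
  have "fps_const (of_nat (Suc p)) * fps_const ((-2) ^ Suc p / fact (Suc p)) =
      - 2 * fps_const ((-2) ^ p / fact p :: complex)"
    by (simp add: field_simps numeral_fps_const flip: fps_const_neg del: of_nat_Suc)
  then show "row (opA * (opT * of_A G) + (opT * of_A G) * opA) p = row 0 p"
    by (simp only: row_opA_anticommutator row_opT_of_A fps_of_nat[symmetric] row_zero
        power_Suc mult.assoc[symmetric]) (simp add: mult_ac del: of_nat_Suc)
qed

text \<open>
  Formally \<open>A B Y + B Y A = Y + B (A Y + Y A)\<close> with \<open>Y = T G(A)\<close>, where the second summand
  vanishes. If \<open>f\<^sub>j\<close> are the rows of \<open>Y\<close>, the row \<open>p\<close> of the left-hand side is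
  \<open>2A f\<^bsub>p-1\<^esub> + (p+1) f\<^sub>p\<close>, and the identity comes from splitting \<open>(p+1) f\<^sub>p\<close> into \<open>p f\<^sub>p\<close> and \<open>f\<^sub>p\<close>.
\<close>

lemma opA_anticommutator_opB_opT_of_A:
  "opA * (opB * (opT * of_A G)) + (opB * (opT * of_A G)) * opA = opT * of_A G"
proof (rule normal_series_eq_rowI)
  fix p
  show "row (opA * (opB * (opT * of_A G)) + (opB * (opT * of_A G)) * opA) p = row (opT * of_A G) p"
  proof (cases p)
    case (Suc n)
    have "row (opA * (opT * of_A G) + (opT * of_A G) * opA) n = 0"
      by (simp only: opA_anticommutes_opT_of_A row_zero)
    then show ?thesis
      unfolding Suc row_opA_anticommutator row_opB_mult by simp algebra
  next
    case 0
    show ?thesis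
      unfolding 0 row_opA_anticommutator row_opB_mult by simp
  qed
qed

section \<open>The constant row of a product\<close>

text \<open>
  The coefficient of \<open>A\<^sup>q\<close> in \<open>A\<^sup>k Y\<close>: a monomial \<open>B\<^sup>m A\<^sup>n\<close> of \<open>Y\<close> contributes to the constant row only
  when all its factors \<open>B\<close> are consumed in the reordering, which leaves
  \<open>m! (k choose m) A\<^bsup>k+n-m\<^esup>\<close>.
\<close>

definition opA_power_row_0 :: "nat \<Rightarrow> normal_series \<Rightarrow> nat \<Rightarrow> complex" where
  "opA_power_row_0 k Y q =
    (\<Sum>m\<le>k. if k \<le> q + m then fact m * of_nat (k choose m) * ns_coeff Y m (q + m - k) else 0)"

lemma opA_power_row_0_add:
  "opA_power_row_0 k (Y + Z) q = opA_power_row_0 k Y q + opA_power_row_0 k Z q"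
  unfolding opA_power_row_0_def sum.distrib[symmetric]
  by (intro sum.cong) (simp_all add: distrib_left)

text \<open>
  Every factor \<open>B\<close> of the left series survives in the normal form of a product, so only its constant
  row contributes. The band condition on \<open>Y\<close> makes the sum finite: it forces \<open>m \<le> n + 1\<close> and hence
  \<open>k = q + m - n \<le> q + 1\<close>. It holds for \<open>T G(A)\<close>, and leaves just enough room for the additional
  factor in \<open>B T G(A)\<close>.
\<close>

lemma ns_coeff_mult_row_0:
  assumes band: "\<And>m n. Suc n < m \<Longrightarrow> ns_coeff Y m n = 0"
  shows "ns_coeff (X * Y) 0 q = (\<Sum>k\<le>Suc q. ns_coeff X 0 k * opA_power_row_0 k Y q)"
proof -
  have coeff: "monom_prod_coeff j k m n 0 q =
      (if j = 0 \<and> m \<le> k \<and> q + m = k + n then fact m * of_nat (k choose m) else 0)" for j k m n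
  proof -
    have "monom_prod_coeff j k m n 0 q =
        (\<Sum>v\<le>min k m. if v = m then
           (if j = 0 \<and> q + m = k + n then fact m * of_nat (k choose m) else 0) else 0)"
      unfolding monom_prod_coeff_def by (intro sum.cong) auto
    then show ?thesis by auto
  qed
  let ?h = "\<lambda>(k, m). (0, k, m, q + m - k) :: nat \<times> nat \<times> nat \<times> nat"
  let ?D = "Sigma {..Suc q} (\<lambda>k. {..k})"
  have inj: "inj_on ?h ?D" by (auto simp: inj_on_def)
  have sub: "{i. prod_term X Y 0 q i \<noteq> 0} \<subseteq> ?h ` ?D"
  proof
    fix i assume "i \<in> {i. prod_term X Y 0 q i \<noteq> 0}"
    then obtain k m n where i: "i = (0, k, m, n)" "m \<le> k" "q + m = k + n" "ns_coeff Y m n \<noteq> 0"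
      by (cases i) (auto simp: prod_term_def coeff split: if_splits)
    with band[of n m] have "k \<le> Suc q" by (cases "Suc n < m") auto
    with i show "i \<in> ?h ` ?D" by (intro image_eqI[of _ _ "(k, m)"]) auto
  qed
  have "ns_coeff (X * Y) 0 q = (\<Sum>(k, m)\<in>?D. prod_term X Y 0 q (0, k, m, q + m - k))"
    by (subst ns_coeff_mult[OF _ sub], simp, subst sum.reindex[OF inj])
      (simp add: case_prod_unfold)
  also have "\<dots> = (\<Sum>k\<le>Suc q. \<Sum>m\<le>k. prod_term X Y 0 q (0, k, m, q + m - k))"
    by (subst sum.Sigma) auto
  also have "\<dots> = (\<Sum>k\<le>Suc q. ns_coeff X 0 k * opA_power_row_0 k Y q)"
    unfolding opA_power_row_0_def sum_distrib_left
    by (intro sum.cong refl) (auto simp: prod_term_def coeff)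
  finally show ?thesis .
qed

text \<open>
  Distributivity can fail where a product is undefined; the band conditions rule this out for
  the constant row by turning it into a finite sum over the same indices in all three products.
\<close>

lemma row_0_mult_add:
  assumes "\<And>m n. Suc n < m \<Longrightarrow> ns_coeff Y m n = 0" "\<And>m n. Suc n < m \<Longrightarrow> ns_coeff Z m n = 0"
  shows "row (X * (Y + Z)) 0 = row (X * Y) 0 + row (X * Z) 0"
proof (rule fps_ext)
  fix q
  have "ns_coeff (X * (Y + Z)) 0 q = (\<Sum>k\<le>Suc q. ns_coeff X 0 k * opA_power_row_0 k (Y + Z) q)"
    by (rule ns_coeff_mult_row_0) (simp add: assms)
  also have "\<dots> = (\<Sum>k\<le>Suc q. ns_coeff X 0 k * opA_power_row_0 k Y q) +
      (\<Sum>k\<le>Suc q. ns_coeff X 0 k * opA_power_row_0 k Z q)"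
    by (simp only: opA_power_row_0_add distrib_left sum.distrib)
  also have "\<dots> = ns_coeff (X * Y) 0 q + ns_coeff (X * Z) 0 q"
    using assms by (simp only: ns_coeff_mult_row_0)
  finally show "fps_nth (row (X * (Y + Z)) 0) q = fps_nth (row (X * Y) 0 + row (X * Z) 0) q"
    by simp
qed

lemma ns_coeff_opT_of_A:
  "ns_coeff (opT * of_A G) m n = (if m \<le> n then (-2) ^ m / fact m * fps_nth G (n - m) else 0)"
proof -
  have "ns_coeff (opT * of_A G) m n = fps_nth (row (opT * of_A G) m) n"
    by (rule row_nth[symmetric])
  then show ?thesis
    by (simp only: row_opT_of_A fps_mult_left_const_nth fps_X_power_mult_nth) simp
qed

lemma ns_coeff_opB_opT_of_A:
  "ns_coeff (opB * (opT * of_A G)) m n =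
    (if 0 < m \<and> m \<le> Suc n then (-2) ^ (m - 1) / fact (m - 1) * fps_nth G (Suc n - m) else 0)"
proof -
  have "ns_coeff (opB * (opT * of_A G)) m n = fps_nth (row (opB * (opT * of_A G)) m) n"
    by (rule row_nth[symmetric])
  then show ?thesis
    by (cases m) (auto simp: row_opB_mult ns_coeff_opT_of_A simp del: row_mult_of_A One_nat_def)
qed

lemma sum_choose_minus_2: "(\<Sum>m\<le>k. of_nat (k choose m) * (-2) ^ m) = ((-1) ^ k :: complex)"
  using binomial_ring[of "-2" "1::complex" k] by simp

text \<open>
  This is \<open>A\<^sup>k T G(A) = T (-A)\<^sup>k G(A)\<close>, the sign coming from \<open>\<Sum>\<^sub>m (k choose m) (-2)\<^sup>m = (1-2)\<^sup>k\<close>.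
\<close>

lemma opA_power_row_0_opT_of_A:
  "opA_power_row_0 k (opT * of_A G) q = (if k \<le> q then (-1) ^ k * fps_nth G (q - k) else 0)"
proof -
  have "opA_power_row_0 k (opT * of_A G) q =
      (\<Sum>m\<le>k. (of_nat (k choose m) * (-2) ^ m) * (if k \<le> q then fps_nth G (q - k) else 0))"
    unfolding opA_power_row_0_def by (intro sum.cong) (auto simp: ns_coeff_opT_of_A)
  then show ?thesis
    by (simp only: sum_distrib_right[symmetric] sum_choose_minus_2) simp
qed

text \<open>
  From \<open>A\<^sup>k B = B A\<^sup>k + k A\<^bsup>k-1\<^esup>\<close> only the second term reaches the constant row, and it is moved past
  \<open>T\<close> as before. In coefficients, \<open>m (k choose m) = k (k-1 choose m-1)\<close> extracts the factor \<open>k\<close>.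
\<close>

lemma opA_power_row_0_opB_opT_of_A:
  assumes "k \<le> Suc q"
  shows "opA_power_row_0 k (opB * (opT * of_A G)) q =
    (if k = 0 then 0 else of_nat k * (-1) ^ (k - 1) * fps_nth G (Suc q - k))"
proof (cases k)
  case (Suc l)
  let ?Y = "opB * (opT * of_A G)"
  have choose: "of_nat (Suc m) * of_nat (Suc l choose Suc m) =
      (of_nat (Suc l) * of_nat (l choose m) :: complex)" for m
    by (metis Suc_times_binomial of_nat_mult)
  have "opA_power_row_0 k ?Y q = (\<Sum>m\<le>l. if l \<le> q + m then
      fact (Suc m) * of_nat (Suc l choose Suc m) * ns_coeff ?Y (Suc m) (q + m - l) else 0)"
    unfolding opA_power_row_0_def Suc
    by (subst sum.atMost_Suc_shift)
      (auto simp: ns_coeff_opB_opT_of_A simp del: binomial_Suc_Suc fact_Suc One_nat_def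
         intro!: sum.cong)
  also have "\<dots> = (\<Sum>m\<le>l. (of_nat (Suc m) * of_nat (Suc l choose Suc m)) *
      ((-2) ^ m * fps_nth G (q - l)))"
    using assms Suc by (intro sum.cong)
      (auto simp: ns_coeff_opB_opT_of_A simp del: of_nat_Suc binomial_Suc_Suc One_nat_def)
  also have "\<dots> = (\<Sum>m\<le>l. of_nat (l choose m) * (-2) ^ m) * (of_nat (Suc l) * fps_nth G (q - l))"
    unfolding choose sum_distrib_right by (intro sum.cong) (simp_all add: mult_ac)
  finally show ?thesis
    by (simp only: sum_choose_minus_2 Suc) simp
qed (simp add: opA_power_row_0_def ns_coeff_opB_opT_of_A del: One_nat_def)

text \<open>
  Summing \<open>A\<^sup>k T G(A) = T (-A)\<^sup>k G(A)\<close> over the terms of the constant row \<open>f\<close> of \<open>X\<close> yields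
  \<open>f(-A) G(A)\<close>.
\<close>

lemma row_0_mult_opT_of_A:
  "row (X * (opT * of_A G)) 0 = fps_reflect (row X 0) * G"
proof (rule fps_ext)
  fix q
  have "ns_coeff (X * (opT * of_A G)) 0 q =
      (\<Sum>k\<le>Suc q. ns_coeff X 0 k * opA_power_row_0 k (opT * of_A G) q)"
    by (rule ns_coeff_mult_row_0) (simp add: ns_coeff_opT_of_A)
  also have "\<dots> = fps_nth (fps_reflect (row X 0) * G) q"
    by (auto simp: opA_power_row_0_opT_of_A fps_mult_nth atMost_atLeast0 intro!: sum.cong)
  finally show "fps_nth (row (X * (opT * of_A G)) 0) q = fps_nth (fps_reflect (row X 0) * G) q"
    by (simp only: row_nth)
qed

text \<open>
  Here the commutator of \<open>f(A)\<close> with \<open>B\<close> supplies \<open>f'(A)\<close>, which is then reflected by \<open>T\<close>.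
\<close>

lemma row_0_mult_opB_opT_of_A:
  "row (X * (opB * (opT * of_A G))) 0 = fps_reflect (fps_deriv (row X 0)) * G"
proof (rule fps_ext)
  fix q
  let ?Y = "opB * (opT * of_A G)"
  have "ns_coeff (X * ?Y) 0 q = (\<Sum>k\<le>Suc q. ns_coeff X 0 k * opA_power_row_0 k ?Y q)"
    by (rule ns_coeff_mult_row_0) (simp add: ns_coeff_opB_opT_of_A del: One_nat_def)
  also have "\<dots> = (\<Sum>k\<le>Suc q. ns_coeff X 0 k *
      (if k = 0 then 0 else of_nat k * (-1) ^ (k - 1) * fps_nth G (Suc q - k)))"
    by (intro sum.cong) (simp_all add: opA_power_row_0_opB_opT_of_A del: One_nat_def)
  also have "\<dots> = fps_nth (fps_reflect (fps_deriv (row X 0)) * G) q"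
    unfolding fps_mult_nth atMost_atLeast0[symmetric] sum.atMost_Suc_shift
    by (auto simp: mult_ac intro!: sum.cong)
  finally show "fps_nth (row (X * ?Y) 0) q = fps_nth (fps_reflect (fps_deriv (row X 0)) * G) q"
    by (simp only: row_nth)
qed

section \<open>The functional equation\<close>

text \<open>
  The evenness hypothesis is the statement that \<open>W(t) W(-t)\<close> has derivative zero, so that
  \<open>W(t) W(-t) = c\<^sup>2\<close> with \<open>c = W(0)\<close>. Hence \<open>W(-t)/c\<^sup>2\<close> is the inverse of \<open>W\<close>, and \<open>\<phi>\<close> is
  obtained by integrating the logarithmic derivative \<open>W'/W\<close>, which is even by the same hypothesis.
\<close>

lemma odd_logarithm_exists:
  fixes W :: "complex fps"
  assumes "W \<noteq> 0" and even: "fps_deriv W * fps_reflect W = fps_reflect (fps_deriv W) * W"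
  obtains c \<phi> where "c \<noteq> 0" "odd_fps \<phi>" "W = fps_const c * (fps_exp 1 oo \<phi>)"
proof -
  define c where "c = fps_nth W 0"
  have "fps_deriv (W * fps_reflect W) = 0"
    using even by (simp add: fps_deriv_reflect algebra_simps)
  then have const: "W * fps_reflect W = fps_const (c ^ 2)"
    unfolding fps_deriv_eq_0_iff by (simp add: c_def power2_eq_square)
  have "fps_reflect W \<noteq> 0"
    using \<open>W \<noteq> 0\<close> by (metis fps_reflect_reflect fps_reflect_zero)
  with const \<open>W \<noteq> 0\<close> have c: "c \<noteq> 0"
    by (metis fps_const_0_eq_0 mult_eq_0_iff power_zero_numeral)
  \<comment> \<open>the logarithmic derivative \<open>W'/W\<close>, with \<open>1/W\<close> written as \<open>W(-t)/c\<^sup>2\<close>\<close>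
  define \<theta> where "\<theta> = fps_const (1 / c ^ 2) * (fps_deriv W * fps_reflect W)"
  define \<phi> where "\<phi> = fps_integral0 \<theta>"
  have \<phi>0: "fps_nth \<phi> 0 = 0" and \<phi>': "fps_deriv \<phi> = \<theta>"
    by (simp_all add: \<phi>_def fps_deriv_fps_integral)
  have "\<theta> * W = fps_const (1 / c ^ 2) * fps_deriv W * (W * fps_reflect W)"
    by (simp add: \<theta>_def mult_ac)
  also have "\<dots> = fps_deriv W * (fps_const (1 / c ^ 2) * fps_const (c ^ 2))"
    unfolding const by (simp only: mult_ac)
  finally have W': "fps_deriv W = \<theta> * W"
    using c by simp
  have "fps_reflect \<theta> = \<theta>"
    using even by (simp add: \<theta>_def mult_ac)
  then have "fps_deriv (fps_reflect \<phi> + \<phi>) = 0"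
    by (simp add: fps_deriv_reflect \<phi>')
  then have "fps_reflect \<phi> + \<phi> = 0"
    unfolding fps_deriv_eq_0_iff by (simp add: \<phi>0)
  then have "odd_fps \<phi>"
    by (simp add: odd_fps_iff_reflect add_eq_0_iff2)
  moreover have "W = fps_const c * (fps_exp 1 oo \<phi>)"
  proof -
    have "fps_deriv (W * (fps_exp (-1) oo \<phi>)) = 0"
      by (simp add: fps_compose_deriv[OF \<phi>0] W' \<phi>' fps_compose_mult_distrib[OF \<phi>0]
          algebra_simps fps_const_neg[symmetric] fps_compose_uminus del: fps_const_neg)
    then have "W * (fps_exp (-1) oo \<phi>) = fps_const c"
      unfolding fps_deriv_eq_0_iff by (simp add: c_def)
    moreover have "(fps_exp (-1) oo \<phi>) * (fps_exp 1 oo \<phi>) = 1"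
      by (simp add: fps_compose_mult_distrib[OF \<phi>0, symmetric] fps_exp_add_mult[symmetric])
    ultimately show ?thesis
      by (metis mult.assoc mult.right_neutral)
  qed
  ultimately show ?thesis
    using that c by blast
qed

text \<open>
  The series \<open>2e\<^sup>t/(e\<^bsup>2t\<^esup>+1)\<close> equals \<open>2/(e\<^sup>t+e\<^bsup>-t\<^esup>)\<close>, which is even; therefore the restriction to
  even indices in \<^const>\<open>euler_egf\<close> loses nothing.
\<close>

lemma euler_egf_mult_cosh:
  "euler_egf * (fps_exp 1 + fps_exp (-1)) = 2"
proof -
  define F :: "complex fps" where "F = 2 * fps_exp 1 / (fps_exp 2 + 1)"
  have "F * (fps_exp 2 + 1) = 2 * fps_exp 1"
    by (simp add: F_def fps_divide_unit mult.assoc inverse_mult_eq_1)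
  moreover have "fps_exp 2 = fps_exp 1 * (fps_exp 1 :: complex fps)"
    and "fps_exp 1 * fps_exp (-1) = (1 :: complex fps)"
    by (simp_all flip: fps_exp_add_mult)
  ultimately have F: "F * (fps_exp 1 + fps_exp (-1)) = 2"
    by algebra
  have "fps_reflect F * (fps_exp 1 + fps_exp (-1)) = 2"
    using arg_cong[OF F, of fps_reflect]
    by (simp add: fps_reflect_exp numeral_fps_const add.commute)
  with F have "fps_reflect F * (fps_exp 1 + fps_exp (-1)) = F * (fps_exp 1 + fps_exp (-1))"
    by simp
  moreover have "fps_exp 1 + fps_exp (-1) \<noteq> (0 :: complex fps)"
    using F by auto
  ultimately have "fps_reflect F = F"
    by simp
  then have "fps_nth F n = 0" if "odd n" for n
    using that fps_reflect_nth[of F n] by simp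
  then have "euler_egf = F"
    by (intro fps_ext) (auto simp: euler_egf_def euler_number_def F_def)
  with F show ?thesis by simp
qed

text \<open>
  Subtracting the reflected equation eliminates \<open>V\<close> and leaves the hypothesis
  of \<open>odd_logarithm_exists\<close> for \<open>W\<close>. What remains is a linear condition on \<open>V\<close>, solved by the
  substitution \<open>v = (e\<^sup>\<phi> \<psi> - \<phi>'/2) / cosh \<phi>\<close>.
\<close>

lemma functional_equation_solution:
  fixes V W :: "complex fps"
  assumes eq: "fps_reflect V * W + fps_reflect W * V + fps_reflect (fps_deriv W) * W = 0"
    and "W \<noteq> 0"
  obtains c \<phi> \<psi> where "c \<noteq> 0" "odd_fps \<phi>" "odd_fps \<psi>"
    "W = fps_const c * (fps_exp 1 oo \<phi>)"
    "V = fps_const c * ((euler_egf oo \<phi>) *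
       ((fps_exp 1 oo \<phi>) * \<psi> - fps_const (1/2) * fps_deriv \<phi>))"
proof -
  have "fps_deriv W * fps_reflect W = fps_reflect (fps_deriv W) * W"
  proof -
    have "V * fps_reflect W + W * fps_reflect V + fps_deriv W * fps_reflect W = 0"
      using arg_cong[OF eq, of fps_reflect] by simp
    with eq show ?thesis by algebra
  qed
  then obtain c \<phi> where c: "c \<noteq> 0" and \<phi>: "odd_fps \<phi>"
    and W: "W = fps_const c * (fps_exp 1 oo \<phi>)"
    using odd_logarithm_exists \<open>W \<noteq> 0\<close> by blast
  have \<phi>0: "fps_nth \<phi> 0 = 0"
    using \<phi> by (simp add: odd_fps_def)
  define e where "e = (fps_exp 1 :: complex fps) oo \<phi>"
  define e' where "e' = (fps_exp (-1) :: complex fps) oo \<phi>"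
  define v where "v = fps_const (1 / c) * V"
  define \<delta> where "\<delta> = fps_deriv \<phi>"
  define h where "h = fps_const (1 / 2 :: complex)"
  have h: "2 * h = 1" and hN: "fps_reflect h = h"
    by (simp_all add: h_def numeral_fps_const)
  have ee': "e * e' = 1"
    by (simp add: e_def e'_def fps_compose_mult_distrib[OF \<phi>0, symmetric] flip: fps_exp_add_mult)
  have \<phi>N: "fps_reflect \<phi> = - \<phi>"
    using \<phi> by (simp add: odd_fps_iff_reflect)
  have "(fps_exp 1 oo - fps_X) oo \<phi> = fps_exp 1 oo (- fps_X oo \<phi>)"
    by (rule fps_compose_assoc[symmetric]) (simp_all add: \<phi>0)
  then have eN: "fps_reflect e = e'"
    by (simp add: e_def e'_def fps_reflect_compose \<phi>0 \<phi>N fps_compose_uminus)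
  then have e'N: "fps_reflect e' = e"
    by (metis fps_reflect_reflect)
  have \<delta>N: "fps_reflect \<delta> = \<delta>"
    using fps_deriv_reflect[of \<phi>] by (simp add: \<phi>N \<delta>_def)
  have V: "V = fps_const c * v"
    using c by (simp add: v_def flip: mult.assoc)
  have W': "fps_deriv W = fps_const c * (\<delta> * e)"
    by (simp add: W e_def \<delta>_def fps_compose_deriv \<phi>0 mult_ac)
  have "fps_const (c ^ 2) * (fps_reflect v * e + e' * v + \<delta>) =
      fps_const c * fps_const c * (fps_reflect v * e + e' * v + \<delta> * (e * e'))"
    by (simp add: ee' power2_eq_square)
  also have "\<dots> = fps_reflect V * W + fps_reflect W * V + fps_reflect (fps_deriv W) * W"
    unfolding W' unfolding V W e_def[symmetric]
    by (simp add: eN \<delta>N algebra_simps)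
  finally have veq: "fps_reflect v * e + e' * v + \<delta> = 0"
    using eq c by simp
  \<comment> \<open>\<open>\<psi> = e\<^bsup>-\<phi>\<^esup> (v cosh \<phi> + \<phi>'/2)\<close>, the solution of \<open>v cosh \<phi> = e\<^sup>\<phi> \<psi> - \<phi>'/2\<close>\<close>
  define \<psi> where "\<psi> = e' * (h * (e + e') * v + h * \<delta>)"
  have "fps_reflect \<psi> + \<psi> =
      h * ((e + e') * (fps_reflect v * e + e' * v + \<delta>))"
    by (simp add: \<psi>_def eN e'N \<delta>N hN algebra_simps)
  then have "fps_reflect \<psi> = - \<psi>"
    by (simp add: veq add_eq_0_iff2)
  then have \<psi>: "odd_fps \<psi>"
    by (simp add: odd_fps_iff_reflect)
  have "(euler_egf oo \<phi>) * (e + e') = (euler_egf * (fps_exp 1 + fps_exp (-1))) oo \<phi>"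
    by (simp add: fps_compose_mult_distrib \<phi>0 fps_compose_add_distrib e_def e'_def)
  then have E: "(euler_egf oo \<phi>) * (e + e') = 2"
    by (simp add: euler_egf_mult_cosh numeral_fps_const)
  have "(euler_egf oo \<phi>) * (e * \<psi> - h * \<delta>) = v"
  proof -
    have "e * \<psi> - h * \<delta> = h * (e + e') * v"
      by (simp add: \<psi>_def ee' flip: mult.assoc)
    then have "(euler_egf oo \<phi>) * (e * \<psi> - h * \<delta>) = ((euler_egf oo \<phi>) * (e + e')) * h * v"
      by (simp only: mult_ac)
    then show ?thesis
      by (simp only: E h mult_1_left)
  qed
  then have "V = fps_const c * ((euler_egf oo \<phi>) *
       ((fps_exp 1 oo \<phi>) * \<psi> - fps_const (1/2) * fps_deriv \<phi>))"
    by (simp add: V e_def h_def \<delta>_def)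
  with c \<phi> \<psi> W that show ?thesis by blast
qed

section \<open>The classification\<close>

theorem theorem2p5:
  fixes A1 A2 A3 :: normal_series
  assumes "A1 = opA"
    and "anticommutator_eq A1 A2 A3"
    and "anticommutator_eq A1 A3 0"
    and "anticommutator_eq A2 A3 0"
  shows "(A3 = 0 \<and> (\<exists>V :: complex fps. A2 = opT * of_A V)) \<or>
    (\<exists>(c :: complex) (\<phi> :: complex fps) (\<psi> :: complex fps).
       c \<noteq> 0 \<and> odd_fps \<phi> \<and> odd_fps \<psi> \<and>
       A2 = c *\<^sub>N (opT * of_A ((euler_egf oo \<phi>) *
              ((fps_exp 1 oo \<phi>) * \<psi> - fps_const (1/2) * fps_deriv \<phi>)))
          + c *\<^sub>N (opB * (opT * of_A (fps_exp 1 oo \<phi>))) \<and>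
       A3 = c *\<^sub>N (opT * of_A (fps_exp 1 oo \<phi>)))"
proof -
  define V where "V = row A2 0"
  define W where "W = row A3 0"
  have A3: "A3 = opT * of_A W"
  proof (rule opA_anticommutator_inject)
    show "opA * A3 + A3 * opA = opA * (opT * of_A W) + (opT * of_A W) * opA"
      unfolding opA_anticommutes_opT_of_A using assms by (simp add: anticommutator_eq_def)
  qed (simp add: W_def row_opT)
  have "opA * A2 + A2 * opA = A3"
    using assms by (simp add: anticommutator_eq_def)
  also have "A3 = opA * (opT * of_A V + opB * (opT * of_A W)) +
      (opT * of_A V + opB * (opT * of_A W)) * opA"
    by (simp only: opA_anticommutator_add opA_anticommutes_opT_of_A opA_anticommutator_opB_opT_of_A
        A3 add_0)
  finally have A2: "A2 = opT * of_A V + opB * (opT * of_A W)"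
    by (rule opA_anticommutator_inject) (simp add: V_def row_opT row_opB_mult del: One_nat_def)
  \<comment> \<open>the constant row of the last relation carries its whole content\<close>
  have "row (A2 * A3 + A3 * A2) 0 = 0"
    using assms by (simp add: anticommutator_eq_def)
  moreover have "row (A2 * A3) 0 = fps_reflect V * W"
    by (subst A3) (simp only: row_0_mult_opT_of_A V_def)
  moreover have "row (A3 * A2) 0 = fps_reflect W * V + fps_reflect (fps_deriv W) * W"
    by (subst A2, subst row_0_mult_add)
      (simp_all only: row_0_mult_opT_of_A row_0_mult_opB_opT_of_A W_def ns_coeff_opT_of_A
        ns_coeff_opB_opT_of_A, auto)
  ultimately have eq: "fps_reflect V * W + fps_reflect W * V + fps_reflect (fps_deriv W) * W = 0"
    by (simp add: add.assoc)
  show ?thesis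
  proof (cases "W = 0")
    case True
    have null: "opT * of_A 0 = 0" "opB * 0 = 0"
      by (rule normal_series_eq_rowI, simp add: row_opB_mult del: One_nat_def)+
    have "A3 = 0"
      using A3 by (simp only: True null)
    moreover have "A2 = opT * of_A V"
      using A2 by (simp only: True null add_0_right)
    ultimately show ?thesis
      by blast
  next
    case False
    then obtain c \<phi> \<psi> where sol: "c \<noteq> 0" "odd_fps \<phi>" "odd_fps \<psi>"
      "W = fps_const c * (fps_exp 1 oo \<phi>)"
      "V = fps_const c * ((euler_egf oo \<phi>) *
         ((fps_exp 1 oo \<phi>) * \<psi> - fps_const (1/2) * fps_deriv \<phi>))"
      using functional_equation_solution[OF eq] by blast
    have scale: "opT * of_A (fps_const c * G) = c *\<^sub>N (opT * of_A G)"
      "opB * (c *\<^sub>N Y) = c *\<^sub>N (opB * Y)" for G Y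
      by (rule normal_series_eq_rowI, simp add: row_opB_mult mult_ac del: One_nat_def)+
    have "A3 = c *\<^sub>N (opT * of_A (fps_exp 1 oo \<phi>))"
      using A3 by (simp only: sol(4) scale)
    moreover have "A2 = c *\<^sub>N (opT * of_A ((euler_egf oo \<phi>) *
        ((fps_exp 1 oo \<phi>) * \<psi> - fps_const (1/2) * fps_deriv \<phi>))) +
      c *\<^sub>N (opB * (opT * of_A (fps_exp 1 oo \<phi>)))"
      using A2 by (simp only: sol(4,5) scale)
    ultimately show ?thesis
      using sol(1-3) by blast
  qed
qed

end
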